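(* For primes $p\equiv1\pmod{12}$, let $g_{p^3}$ be the genus of $X_0(p^3)$ and let $V_0,V_\infty$ be the vertical $\mathbb{Q}$-divisors on the minimal regular model $\mathcal{X}_0(p^3)$ over $\mathbb{Z}$ given explicitly in the context. Then $$\frac{1}{g_{p^3}-1}\left(g_{p^3}\langle V_0,V_\infty\rangle-\frac{V_0^2+V_\infty^2}{2}\right)=3\,g_{p^3}\log(p)+o\big(g_{p^3}\log p\big)\quad\text{as }p\to\infty,$$ with $p$ running over primes $\equiv1\pmod{12}$.
   Context: For $p\equiv1\pmod{12}$ one has $g_{p^3}=1+\frac{p(p+4)(p-3)-14}{12}$. $\mathcal{X}_0(p^3)$ is the minimal regular model of $X_0(p^3)$ over $\mathbb{Z}$ (it is Edixhoven's regular model). Its fibre over $\mathbb{F}_p$ has components $C_{3,0},C_{0,3},C_{2,1},C_{1,2}$ ($C_{a,b}$ being the reduced Katz–Mazur $(a,b)$-component) and exceptional components $E_1,E_2$ (over $j=1728$) and $F_1,F_2$ (over $j=0$). Their intersection matrix, in the order $C_{3,0},C_{0,3},C_{2,1},C_{1,2},E_1,E_2,F_1,F_2$, is $$\begin{pmatrix} -\frac{p^2(p-1)}{12} & \frac{p-1}{12} & \frac{p(p-1)}{12} & \frac{p-1}{12} & 0&0&0&0\\ \frac{p-1}{12} & -\frac{p^2(p-1)}{12} & \frac{p-1}{12} & \frac{p(p-1)}{12} & 0&0&0&0\\ \frac{p(p-1)}{12} & \frac{p-1}{12} & -\frac{p+5}{6} & \frac{p-1}{12} & 1&0&1&0\\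 \frac{p-1}{12} & \frac{p(p-1)}{12} & \frac{p-1}{12} & -\frac{p+5}{6} & 0&1&0&1\\ 0&0&1&0&-2&0&0&0\\ 0&0&0&1&0&-2&0&0\\ 0&0&1&0&0&0&-3&0\\ 0&0&0&1&0&0&0&-3 \end{pmatrix}.$$ For vertical divisors over $p$, the Arakelov pairing is $\langle V,W\rangle=(V\cdot W)\log p$ with $V\cdot W$ the usual intersection number, and $V^2=\langle V,V\rangle$. The divisors are $V_0=x_1C_{3,0}+x_2C_{0,3}+x_3C_{2,1}+x_4C_{1,2}+x_5E_1+x_6E_2+x_7F_1+x_8F_2$ and $V_\infty=x_1'C_{3,0}+x_2'C_{0,3}+x_3'C_{2,1}+x_4'C_{1,2}+x_5'E_1+x_6'E_2+x_7'F_1+x_8'F_2$ with $x_1=\frac{2p^4-2p^3-16p^2-16p+14}{p^4-p^2}$, $x_2=\frac{-p^3-4p^2+21p+14}{p^3-p}$, $x_3=\frac{p^4-p^3-14p^2-2p+14}{p^3+p^2}$, $x_4=-1$, $x_5=\frac{\frac12p^4-\frac12p^3-7p^2-p+7}{p^3+p^2}$, $x_6=-\frac12$, $x_7=\frac{\frac13p^4-\frac{13}{3}p^2-\frac23p+\frac{14}{3}}{p^3+p^2}$, $x_8=0$; $x_1'=\frac{-2p^4-4p^3+34p^2+16p-14}{p^4-p^2}$, $x_2'=\frac{p^3-2p^2-3p-14}{p^3-p}$, $x_3'=\frac{-p^4-p^3+12p^2+2p-14}{p^3+p^2}$, $x_4'=-1$, $x_5'=\frac{-\frac12p^4-\frac12p^3+6p^2+p-7}{p^3+p^2}$,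 $x_6'=-\frac12$, $x_7'=\frac{-\frac13p^4+\frac{13}{3}p^2+\frac23p-\frac{14}{3}}{p^3+p^2}$, $x_8'=0$. (They are chosen so that, for $m\in\{0,\infty\}$, $K-(2g_{p^3}-2)H_m+V_m$ is orthogonal to all vertical divisors, where $K$ is a canonical divisor of $\mathcal{X}_0(p^3)$ and $H_0,H_\infty$ are the sections given by the cusps $0,\infty$, meeting $C_{0,3}$ and $C_{3,0}$ respectively.) *)

theory Defs
  imports "HOL-Analysis.Analysis" "HOL-Library.Landau_Symbols" "HOL-Number_Theory.Number_Theory"
begin

section \<open>The genus of X_0(N)\<close>

definition SL2Z :: "(int^2^2) set" where
  "SL2Z = {A. det A = 1}"

definition Gamma0 :: "nat \<Rightarrow> (int^2^2) set" where
  "Gamma0 N = {A \<in> SL2Z. int N dvd A $ 2 $ 1}"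

definition moebius :: "int^2^2 \<Rightarrow> complex \<Rightarrow> complex" where
  "moebius A z =
     (of_int (A $ 1 $ 1) * z + of_int (A $ 1 $ 2)) / (of_int (A $ 2 $ 1) * z + of_int (A $ 2 $ 2))"

definition orbits :: "'g set \<Rightarrow> ('g \<Rightarrow> 'x \<Rightarrow> 'x) \<Rightarrow> 'x set \<Rightarrow> 'x set set" where
  "orbits G act X = (\<lambda>x. (\<lambda>g. act g x) ` G) ` X"

text \<open>
  The index of Gamma0 N in SL2Z. As both groups contain -1, it is also the index of their images
  in PSL2(Z), that is, the degree of the covering of X_0(1) by X_0(N).
\<close>

definition index_Gamma0 :: "nat \<Rightarrow> nat" where
  "index_Gamma0 N = card (orbits (Gamma0 N) (**) SL2Z)"

definition points_over_i :: "nat \<Rightarrow> complex set set" where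
  "points_over_i N = orbits (Gamma0 N) moebius ((\<lambda>A. moebius A \<i>) ` SL2Z)"

definition points_over_rho :: "nat \<Rightarrow> complex set set" where
  "points_over_rho N = orbits (Gamma0 N) moebius ((\<lambda>A. moebius A (cis (2 * pi / 3))) ` SL2Z)"

text \<open>
  A point of the rational projective line is a primitive integer column (a, c) up to sign, standing
  for a / c. As -1 lies in Gamma0 N, the orbits of Gamma0 N on primitive columns are its orbits on
  the projective line.
\<close>

definition cusps :: "nat \<Rightarrow> (int^2) set set" where
  "cusps N = orbits (Gamma0 N) (*v) {v. coprime (v $ 1) (v $ 2)}"

text \<open>
  The tessellation of the extended upper half plane by the images under SL2Z of the two hyperbolic
  triangles with vertices i, rho = exp(2 pi i / 3), infinity and i, rho + 1, infinity induces a
  triangulation of the compact Riemann surface X_0(N): its vertices are the points over i, the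
  points over rho and the cusps, and with d the index of Gamma0 N it has 3 d edges and 2 d faces
  (PSL2(Z) acts freely on edges and faces). The genus is defined by the Euler characteristic
  2 - 2 g = V - E + F; this is the Riemann-Hurwitz formula for the covering of X_0(1) by X_0(N).
\<close>

definition euler_char_X0 :: "nat \<Rightarrow> int" where
  "euler_char_X0 N =
     int (card (points_over_i N) + card (points_over_rho N) + card (cusps N))
     - int (3 * index_Gamma0 N) + int (2 * index_Gamma0 N)"

definition genus_X0 :: "nat \<Rightarrow> real" where
  "genus_X0 N = 1 - of_int (euler_char_X0 N) / 2"


section \<open>Vertical divisors on the minimal regular model of X_0(p^3)\<close>

text \<open>
  Throughout, p is a prime congruent to 1 modulo 12. The fibre over p of the minimal regular model
  enters through its components and their intersection matrix: C30, C03, C21, C12 are the reduced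
  Katz-Mazur components, E1, E2 the exceptional components over j = 1728 and F1, F2 those over
  j = 0.
\<close>

datatype fibre_component = C30 | C03 | C21 | C12 | E1 | E2 | F1 | F2

lemma UNIV_fibre_component: "UNIV = {C30, C03, C21, C12, E1, E2, F1, F2}"
  by (auto intro: fibre_component.exhaust)

instance fibre_component :: finite
  by standard (simp add: UNIV_fibre_component)

fun position :: "fibre_component \<Rightarrow> nat" where
  "position C30 = 0"
| "position C03 = 1"
| "position C21 = 2"
| "position C12 = 3"
| "position E1 = 4"
| "position E2 = 5"
| "position F1 = 6"
| "position F2 = 7"

definition intersection_matrix :: "nat \<Rightarrow> rat list list" where
  "intersection_matrix n =
     (let p = rat_of_nat n; a = (p - 1) / 12 in
      [[- (p^2 * a),          a,     p * a,               a,  0,  0,  0,  0],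
       [          a, - (p^2 * a),        a,           p * a,  0,  0,  0,  0],
       [      p * a,          a, - ((p + 5) / 6),         a,  1,  0,  1,  0],
       [          a,      p * a,         a, - ((p + 5) / 6),  0,  1,  0,  1],
       [          0,          0,         1,               0, -2,  0,  0,  0],
       [          0,          0,         0,               1,  0, -2,  0,  0],
       [          0,          0,         1,               0,  0,  0, -3,  0],
       [          0,          0,         0,               1,  0,  0,  0, -3]])"

definition component_intersection :: "nat \<Rightarrow> fibre_component \<Rightarrow> fibre_component \<Rightarrow> rat" where
  "component_intersection p C D = intersection_matrix p ! position C ! position D"

text \<open>A vertical Q-divisor over p is given by the multiplicity of each component.\<close>

type_synonym vertical_divisor = "fibre_component \<Rightarrow> rat"

definition intersection_number :: "nat \<Rightarrow> vertical_divisor \<Rightarrow> vertical_divisor \<Rightarrow> rat" where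
  "intersection_number p V W =
     (\<Sum>C\<in>UNIV. \<Sum>D\<in>UNIV. V C * W D * component_intersection p C D)"

definition arakelov_pairing :: "nat \<Rightarrow> vertical_divisor \<Rightarrow> vertical_divisor \<Rightarrow> real" where
  "arakelov_pairing p V W = of_rat (intersection_number p V W) * ln (real p)"

definition V_zero :: "nat \<Rightarrow> vertical_divisor" where
  "V_zero n C =
     (let p = rat_of_nat n in
      case C of
        C30 \<Rightarrow> (2 * p^4 - 2 * p^3 - 16 * p^2 - 16 * p + 14) / (p^4 - p^2)
      | C03 \<Rightarrow> (- (p^3) - 4 * p^2 + 21 * p + 14) / (p^3 - p)
      | C21 \<Rightarrow> (p^4 - p^3 - 14 * p^2 - 2 * p + 14) / (p^3 + p^2)
      | C12 \<Rightarrow> - 1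
      | E1 \<Rightarrow> (1/2 * p^4 - 1/2 * p^3 - 7 * p^2 - p + 7) / (p^3 + p^2)
      | E2 \<Rightarrow> - (1/2)
      | F1 \<Rightarrow> (1/3 * p^4 - 13/3 * p^2 - 2/3 * p + 14/3) / (p^3 + p^2)
      | F2 \<Rightarrow> 0)"

definition V_infinity :: "nat \<Rightarrow> vertical_divisor" where
  "V_infinity n C =
     (let p = rat_of_nat n in
      case C of
        C30 \<Rightarrow> (- 2 * p^4 - 4 * p^3 + 34 * p^2 + 16 * p - 14) / (p^4 - p^2)
      | C03 \<Rightarrow> (p^3 - 2 * p^2 - 3 * p - 14) / (p^3 - p)
      | C21 \<Rightarrow> (- (p^4) - p^3 + 12 * p^2 + 2 * p - 14) / (p^3 + p^2)
      | C12 \<Rightarrow> - 1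
      | E1 \<Rightarrow> (- (1/2) * p^4 - 1/2 * p^3 + 6 * p^2 + p - 7) / (p^3 + p^2)
      | E2 \<Rightarrow> - (1/2)
      | F1 \<Rightarrow> (- (1/3) * p^4 + 13/3 * p^2 + 2/3 * p - 14/3) / (p^3 + p^2)
      | F2 \<Rightarrow> 0)"

end

theory Submission
  imports Defs "HOL-Real_Asymp.Real_Asymp"
begin

text \<open>
  Everything is measured against $p^3$. The genus satisfies $g = p^3/12 + O(p^2)$, so $3g$ is
  $p^3/4$ to leading order, and the intersection numbers satisfy $V_0 \cdot V_\infty \sim p^3/4$,
  whereas $V_0^2$ and $V_\infty^2$ are only $O(p^3)$. Hence the quotient in question is
  $(V_0 \cdot V_\infty) \log p \, (1 + o(1)) + O(\log p)$, and the leading terms agree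
  (\<open>leading_term_smallo\<close>). The coefficient 1/4 is pure bookkeeping in the leading terms of the
  multiplicities and of the intersection matrix (\<open>intersection_number_asymptotics\<close>).
  
  The substance is the genus, which is defined by counting orbits. Two elements of $SL_2(Z)$ lie in
  the same coset of $\Gamma_0(N)$ iff the cross product of their bottom rows vanishes modulo $N$; for
  $N = p^{n+1}$ this yields explicit representatives and the index $d = p^{n+1} + p^n$
  (\<open>index_Gamma0_prime_power\<close>). The cosets map onto the points over $i$ and over $\rho$, and
  the fibre through the coset of $A$ consists of the cosets of $A k$, where $k$ runs over the
  stabiliser modulo $\pm 1$, of order 2 or 3. Such a fibre is smaller than this order only if the
  bottom row of $A$ is a zero modulo $N$ of a binary quadratic form of discriminant $-4$ or $-3$,
  which happens for at most two cosets. So there are $d/2 + O(1)$ points over $i$ and $d/3 + O(1)$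
  points over $\rho$ (\<open>card_elliptic_points\<close>). The number of cusps is at most $p^n + 1$, because
  right translation by $(1, 1; 0, 1)$ fuses all cosets whose bottom row starts with a unit
  (\<open>card_cusps_le\<close>). Altogether $g = d/12 + O(p^n)$.
\<close>

section \<open>Integral matrices and orbits of $\Gamma_0(N)$\<close>

definition mat2 :: "int \<Rightarrow> int \<Rightarrow> int \<Rightarrow> int \<Rightarrow> int^2^2" where
  "mat2 a b c d = vector [vector [a, b], vector [c, d]]"

lemma mat2_nth [simp]:
  "mat2 a b c d $ 1 $ 1 = a" "mat2 a b c d $ 1 $ 2 = b"
  "mat2 a b c d $ 2 $ 1 = c" "mat2 a b c d $ 2 $ 2 = d"
  by (simp_all add: mat2_def)

lemma mat2_eq_iff:
  fixes A B :: "int^2^2"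
  shows "A = B \<longleftrightarrow> A $ 1 $ 1 = B $ 1 $ 1 \<and> A $ 1 $ 2 = B $ 1 $ 2 \<and>
    A $ 2 $ 1 = B $ 2 $ 1 \<and> A $ 2 $ 2 = B $ 2 $ 2"
  by (auto simp: vec_eq_iff forall_2)

lemma mat2_mult_nth:
  fixes A B :: "int^2^2"
  shows "(A ** B) $ i $ j = A $ i $ 1 * B $ 1 $ j + A $ i $ 2 * B $ 2 $ j"
  by (simp add: matrix_matrix_mult_def sum_2)

lemma mat_one_nth [simp]:
  "(mat 1 :: int^2^2) $ 1 $ 1 = 1" "(mat 1 :: int^2^2) $ 1 $ 2 = 0"
  "(mat 1 :: int^2^2) $ 2 $ 1 = 0" "(mat 1 :: int^2^2) $ 2 $ 2 = 1"
  by (simp_all add: mat_def)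

lemma SL2Z_iff: "A \<in> SL2Z \<longleftrightarrow> A $ 1 $ 1 * A $ 2 $ 2 - A $ 1 $ 2 * A $ 2 $ 1 = 1"
  by (simp add: SL2Z_def det_2)

text \<open>
  The adjugate serves as the inverse on $SL_2(Z)$; it is given by its entries so that membership in
  $\Gamma_0(N)$ can be read off.
\<close>

definition adj2 :: "int^2^2 \<Rightarrow> int^2^2" where
  "adj2 A = mat2 (A $ 2 $ 2) (- (A $ 1 $ 2)) (- (A $ 2 $ 1)) (A $ 1 $ 1)"

lemma adj2_mult:
  assumes "A \<in> SL2Z"
  shows "adj2 A ** A = mat 1" "A ** adj2 A = mat 1"
  using assms by (simp_all add: SL2Z_iff adj2_def mat2_eq_iff mat2_mult_nth algebra_simps)

lemma SL2Z_mult: "A \<in> SL2Z \<Longrightarrow> B \<in> SL2Z \<Longrightarrow> A ** B \<in> SL2Z"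
  by (simp add: SL2Z_def det_mul)

lemma SL2Z_adj2: "A \<in> SL2Z \<Longrightarrow> adj2 A \<in> SL2Z"
  by (simp add: SL2Z_iff adj2_def algebra_simps)

lemma SL2Z_one: "mat 1 \<in> SL2Z"
  by (simp add: SL2Z_def)

lemma Gamma0_SL2Z: "A \<in> Gamma0 N \<Longrightarrow> A \<in> SL2Z"
  by (simp add: Gamma0_def)

lemma Gamma0_mult: "A \<in> Gamma0 N \<Longrightarrow> B \<in> Gamma0 N \<Longrightarrow> A ** B \<in> Gamma0 N"
  by (simp add: Gamma0_def SL2Z_mult mat2_mult_nth)

lemma Gamma0_adj2: "A \<in> Gamma0 N \<Longrightarrow> adj2 A \<in> Gamma0 N"
  by (simp add: Gamma0_def SL2Z_adj2) (simp add: adj2_def)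

lemma Gamma0_one: "mat 1 \<in> Gamma0 N"
  by (simp add: Gamma0_def SL2Z_one)

text \<open>
  The composition law is required at the single point $x$ only: the actions considered here are
  well behaved merely on part of their type (Moebius transformations have poles).
\<close>

lemma orbit_eq_iff:
  assumes one: "act (mat 1) x = x" "act (mat 1) y = y"
    and comp: "\<And>g h. g \<in> Gamma0 N \<Longrightarrow> h \<in> Gamma0 N \<Longrightarrow> act (g ** h) x = act g (act h x)"
  shows "(\<lambda>g. act g x) ` Gamma0 N = (\<lambda>g. act g y) ` Gamma0 N \<longleftrightarrow>
    (\<exists>g\<in>Gamma0 N. y = act g x)"
proof
  assume "(\<lambda>g. act g x) ` Gamma0 N = (\<lambda>g. act g y) ` Gamma0 N"
  moreover have "y \<in> (\<lambda>g. act g y) ` Gamma0 N"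
    using one(2) Gamma0_one by force
  ultimately show "\<exists>g\<in>Gamma0 N. y = act g x" by blast
next
  assume "\<exists>g\<in>Gamma0 N. y = act g x"
  then obtain g where g: "g \<in> Gamma0 N" and y: "y = act g x" by blast
  have "act h y = act (h ** g) x" if "h \<in> Gamma0 N" for h
    using comp[OF that g] y by simp
  moreover have "act h x = act (h ** adj2 g) y" if "h \<in> Gamma0 N" for h
  proof -
    have "act (h ** adj2 g) y = act ((h ** adj2 g) ** g) x"
      unfolding y by (rule comp[symmetric]) (use that g in \<open>auto intro: Gamma0_mult Gamma0_adj2\<close>)
    also have "(h ** adj2 g) ** g = h"
      by (metis adj2_mult(1) Gamma0_SL2Z g matrix_mul_assoc matrix_mul_rid)
    finally show ?thesis by simp
  qed
  ultimately show "(\<lambda>g. act g x) ` Gamma0 N = (\<lambda>g. act g y) ` Gamma0 N"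
    using g by (auto simp: image_iff) (metis Gamma0_mult Gamma0_adj2)+
qed

section \<open>Cosets of $\Gamma_0(p^{n+1})$\<close>

text \<open>
  The determinant of the two bottom rows. Up to sign it is the lower left entry of $B A^{-1}$, so it
  decides whether $A$ and $B$ lie in the same coset of $\Gamma_0(N)$, and it tests equality of the
  bottom rows as points of the projective line over $Z/N$.
\<close>

definition bottom_cross :: "int^2^2 \<Rightarrow> int^2^2 \<Rightarrow> int" where
  "bottom_cross A B = A $ 2 $ 1 * B $ 2 $ 2 - A $ 2 $ 2 * B $ 2 $ 1"

lemma coset_eq_iff:
  assumes "A \<in> SL2Z" "B \<in> SL2Z"
  shows "(\<exists>g\<in>Gamma0 N. B = g ** A) \<longleftrightarrow> int N dvd bottom_cross A B"
proof
  assume "\<exists>g\<in>Gamma0 N. B = g ** A"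
  then obtain g where g: "g \<in> Gamma0 N" and B: "B = g ** A" by blast
  have "bottom_cross A B = - (g $ 2 $ 1) * (A $ 1 $ 1 * A $ 2 $ 2 - A $ 1 $ 2 * A $ 2 $ 1)"
    by (simp add: bottom_cross_def B mat2_mult_nth algebra_simps)
  with g show "int N dvd bottom_cross A B" by (simp add: Gamma0_def)
next
  assume dv: "int N dvd bottom_cross A B"
  have "(B ** adj2 A) $ 2 $ 1 = - bottom_cross A B"
    by (simp add: bottom_cross_def adj2_def mat2_mult_nth)
  with dv have "B ** adj2 A \<in> Gamma0 N"
    using assms by (simp add: Gamma0_def SL2Z_mult SL2Z_adj2)
  moreover have "B = (B ** adj2 A) ** A"
    by (metis adj2_mult(1) assms(1) matrix_mul_assoc matrix_mul_rid)
  ultimately show "\<exists>g\<in>Gamma0 N. B = g ** A" by blast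
qed

lemma coset_orbits_eq_iff:
  assumes "A \<in> SL2Z" "B \<in> SL2Z"
  shows "(\<lambda>g. g ** A) ` Gamma0 N = (\<lambda>g. g ** B) ` Gamma0 N \<longleftrightarrow> int N dvd bottom_cross A B"
  using coset_eq_iff[OF assms] by (subst orbit_eq_iff) (auto simp: matrix_mul_assoc)

text \<open>
  The bottom rows are the points $(1 : j)$ and $(p j : 1)$ of the projective line over $Z/p^{n+1}$.
\<close>

definition coset_reps :: "nat \<Rightarrow> nat \<Rightarrow> (int^2^2) set" where
  "coset_reps p n = (\<lambda>j. mat2 0 (-1) 1 (int j)) ` {..<p ^ Suc n} \<union>
     (\<lambda>j. mat2 1 0 (int (p * j)) 1) ` {..<p ^ n}"

lemma coset_reps_SL2Z: "A \<in> coset_reps p n \<Longrightarrow> A \<in> SL2Z"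
  by (auto simp: coset_reps_def SL2Z_iff)

lemma finite_coset_reps: "finite (coset_reps p n)"
  by (simp add: coset_reps_def)

lemma card_coset_reps:
  assumes "prime p"
  shows "card (coset_reps p n) = p ^ Suc n + p ^ n"
proof -
  have "p > 0" using assms by (simp add: prime_gt_0_nat)
  then have "inj_on (\<lambda>j. mat2 1 0 (int (p * j)) 1) {..<p ^ n}"
    by (auto simp: inj_on_def mat2_eq_iff)
  moreover have "inj_on (\<lambda>j. mat2 0 (-1) 1 (int j)) {..<p ^ Suc n}"
    by (auto simp: inj_on_def mat2_eq_iff)
  ultimately show ?thesis
    unfolding coset_reps_def
    by (subst card_Un_disjoint) (auto simp: card_image mat2_eq_iff)
qed

lemma eq_if_dvd_diff_less:
  assumes "int M dvd int i - int j" "i < M" "j < M"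
  shows "i = j"
  using assms by (metis cong_iff_dvd_diff cong_int_iff cong_less_modulus_unique_nat)

lemma coset_reps_unique:
  assumes p: "prime p" and A: "A \<in> coset_reps p n" and B: "B \<in> coset_reps p n"
    and dv: "int (p ^ Suc n) dvd bottom_cross A B"
  shows "A = B"
proof -
  have not1: "\<not> int p dvd 1 - int p * x" "\<not> int p dvd int p * x - 1" for x
    using p by (auto simp: dvd_diff_right_iff dvd_diff_left_iff prime_nat_iff)
  have pd: "int p dvd bottom_cross A B"
    using dv by (metis dvd_trans dvd_triv_left of_nat_dvd_iff power_Suc)
  consider i j where "i < p ^ Suc n" "j < p ^ Suc n" "A = mat2 0 (-1) 1 (int i)" "B = mat2 0 (-1) 1 (int j)"
    | i j where "A = mat2 0 (-1) 1 (int i)" "B = mat2 1 0 (int (p * j)) 1"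
    | i j where "A = mat2 1 0 (int (p * j)) 1" "B = mat2 0 (-1) 1 (int i)"
    | i j where "i < p ^ n" "j < p ^ n" "A = mat2 1 0 (int (p * i)) 1" "B = mat2 1 0 (int (p * j)) 1"
    using A B unfolding coset_reps_def by blast
  then show ?thesis
  proof cases
    case 1
    with dv have "int (p ^ Suc n) dvd int j - int i" by (simp add: bottom_cross_def)
    with 1 have "j = i" by (intro eq_if_dvd_diff_less)
    with 1 show ?thesis by simp
  next
    case 2
    with pd not1(1)[of "int i * int j"] show ?thesis by (simp add: bottom_cross_def ac_simps)
  next
    case 3
    with pd not1(2)[of "int i * int j"] show ?thesis by (simp add: bottom_cross_def ac_simps)
  next
    case 4
    with dv have "int p * int (p ^ n) dvd int p * (int i - int j)"
      by (simp add: bottom_cross_def algebra_simps)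
    then have "int (p ^ n) dvd int i - int j" using p by (simp add: prime_gt_0_nat)
    with 4 have "i = j" by (intro eq_if_dvd_diff_less)
    with 4 show ?thesis by simp
  qed
qed

text \<open>
  In a primitive bottom row $(c, d)$ one of the entries is a unit modulo $p$; scaling it to 1 gives
  the normal form.
\<close>

lemma coset_reps_exists:
  assumes p: "prime p" and A: "A \<in> SL2Z"
  shows "\<exists>R\<in>coset_reps p n. int (p ^ Suc n) dvd bottom_cross R A"
proof -
  define c d where "c = A $ 2 $ 1" and "d = A $ 2 $ 2"
  let ?N = "int (p ^ Suc n)"
  have N: "?N > 0" using p by (simp add: prime_gt_0_nat)
  have cop: "coprime c d"
  proof (rule coprimeI)
    fix x assume "x dvd c" "x dvd d"
    then have "x dvd A $ 1 $ 1 * d - A $ 1 $ 2 * c" by simp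
    then show "is_unit x" using A by (simp add: SL2Z_iff c_def d_def)
  qed
  have inv: "\<exists>y. ?N dvd u * y - 1" if "\<not> int p dvd u" for u
  proof -
    have "coprime u ?N"
      using prime_imp_coprime[of "int p" u] that p by (simp add: coprime_commute)
    then show ?thesis
      using cong_solve_coprime_int[of u ?N] by (auto simp: cong_iff_dvd_diff)
  qed
  show ?thesis
  proof (cases "int p dvd c")
    case False
    then obtain y where y: "?N dvd c * y - 1" using inv by blast
    define j where "j = nat ((y * d) mod ?N)"
    have j: "int j = (y * d) mod ?N" using N by (simp add: j_def)
    have "j < p ^ Suc n" using N by (simp add: j_def nat_less_iff del: power_Suc of_nat_power)
    moreover have "?N dvd d - int j * c"
    proof -
      have "?N dvd y * d - int j" unfolding j by (simp add: dvd_minus_mod)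
      then have "?N dvd c * (y * d - int j) - d * (c * y - 1)"
        using y by (metis dvd_diff dvd_mult)
      then show ?thesis by (simp add: algebra_simps)
    qed
    ultimately show ?thesis
      by (intro bexI[of _ "mat2 0 (-1) 1 (int j)"])
        (auto simp: bottom_cross_def coset_reps_def c_def d_def)
  next
    case True
    then obtain e where e: "c = int p * e" by blast
    have "\<not> int p dvd d"
      using True cop p by (metis coprime_common_divisor not_prime_unit prime_nat_int_transfer)
    then obtain y where y: "?N dvd d * y - 1" using inv by blast
    define j where "j = nat ((y * e) mod int (p ^ n))"
    have M: "int (p ^ n) > 0" using p by (simp add: prime_gt_0_nat)
    have j: "int j = (y * e) mod int (p ^ n)" using M by (simp add: j_def)
    have "j < p ^ n" using M by (simp add: j_def nat_less_iff del: of_nat_power)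
    moreover have "?N dvd int (p * j) * d - c"
    proof -
      have "int (p ^ n) dvd y * e - int j" unfolding j by (simp add: dvd_minus_mod)
      then have "?N dvd int p * (y * e - int j)" by (simp add: mult_dvd_mono)
      then have "?N dvd c * (d * y - 1) - d * (int p * (y * e - int j))"
        using y by (metis dvd_diff dvd_mult)
      then show ?thesis by (simp add: e algebra_simps)
    qed
    ultimately show ?thesis
      by (intro bexI[of _ "mat2 1 0 (int (p * j)) 1"])
        (auto simp: bottom_cross_def coset_reps_def c_def d_def)
  qed
qed

text \<open>
  This covers all four orbit counts: if the set acted on is a single $SL_2(Z)$-orbit, swept out by
  \<open>act'\<close>, then every orbit of $\Gamma_0(p^{n+1})$ contains the image of a coset representative.
\<close>

lemma orbits_eq_image_coset_reps:
  assumes p: "prime p"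
    and one: "\<And>A. A \<in> SL2Z \<Longrightarrow> act (mat 1) (act' A) = act' A"
    and comp: "\<And>g A. g \<in> SL2Z \<Longrightarrow> A \<in> SL2Z \<Longrightarrow> act g (act' A) = act' (g ** A)"
  shows "orbits (Gamma0 (p ^ Suc n)) act (act' ` SL2Z) =
    (\<lambda>A. (\<lambda>g. act g (act' A)) ` Gamma0 (p ^ Suc n)) ` coset_reps p n"
proof -
  let ?G = "Gamma0 (p ^ Suc n)"
  have "\<exists>R\<in>coset_reps p n. (\<lambda>g. act g (act' A)) ` ?G = (\<lambda>g. act g (act' R)) ` ?G" if A: "A \<in> SL2Z" for A
  proof -
    obtain R where R: "R \<in> coset_reps p n" "int (p ^ Suc n) dvd bottom_cross R A"
      using coset_reps_exists[OF p A] by blast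
    then obtain g where g: "g \<in> ?G" "A = g ** R"
      using coset_eq_iff A coset_reps_SL2Z by blast
    have RS: "R \<in> SL2Z" using R coset_reps_SL2Z by blast
    have "(\<lambda>g. act g (act' R)) ` ?G = (\<lambda>g. act g (act' A)) ` ?G"
    proof (subst orbit_eq_iff)
      show "\<exists>g\<in>?G. act' A = act g (act' R)"
        using g RS comp Gamma0_SL2Z by metis
      show "act (g ** h) (act' R) = act g (act h (act' R))" if "g \<in> ?G" "h \<in> ?G" for g h
        using that RS by (simp add: Gamma0_SL2Z comp SL2Z_mult matrix_mul_assoc)
    qed (use one A RS in auto)
    with R show ?thesis by blast
  qed
  then show ?thesis
    unfolding orbits_def image_image using coset_reps_SL2Z by (auto simp: image_iff)
qed

lemma index_Gamma0_prime_power: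
  assumes p: "prime p"
  shows "index_Gamma0 (p ^ Suc n) = p ^ Suc n + p ^ n"
proof -
  let ?G = "Gamma0 (p ^ Suc n)"
  have "orbits ?G (**) ((\<lambda>A. A) ` SL2Z) = (\<lambda>A. (\<lambda>g. g ** A) ` ?G) ` coset_reps p n"
    by (rule orbits_eq_image_coset_reps) (use p in auto)
  moreover have "inj_on (\<lambda>A. (\<lambda>g. g ** A) ` ?G) (coset_reps p n)"
  proof (rule inj_onI)
    fix A B assume AB: "A \<in> coset_reps p n" "B \<in> coset_reps p n"
      and eq: "(\<lambda>g. g ** A) ` ?G = (\<lambda>g. g ** B) ` ?G"
    have "\<exists>g\<in>?G. B = g ** A"
      using eq by (subst (asm) orbit_eq_iff) (auto simp: matrix_mul_assoc)
    then have "int (p ^ Suc n) dvd bottom_cross A B"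
      using coset_eq_iff AB coset_reps_SL2Z by blast
    then show "A = B" using coset_reps_unique p AB by blast
  qed
  ultimately show ?thesis
    by (simp add: index_Gamma0_def card_image card_coset_reps[OF p])
qed

section \<open>Cusps\<close>

lemma primitive_columns: "{v :: int^2. coprime (v $ 1) (v $ 2)} = (\<lambda>A. A *v axis 1 1) ` SL2Z"
proof (intro equalityI subsetI)
  fix v :: "int^2" assume "v \<in> {v. coprime (v $ 1) (v $ 2)}"
  then have "coprime (v $ 1) (v $ 2)" by simp
  then obtain x y where xy: "x * v $ 1 + y * v $ 2 = 1"
    using bezout_int[of "v $ 1" "v $ 2"] by auto
  have "v = mat2 (v $ 1) (- y) (v $ 2) x *v axis 1 1"
    by (simp add: vec_eq_iff forall_2 matrix_vector_mult_def sum_2 axis_def)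
  moreover have "mat2 (v $ 1) (- y) (v $ 2) x \<in> SL2Z"
    using xy by (simp add: SL2Z_iff algebra_simps)
  ultimately show "v \<in> (\<lambda>A. A *v axis 1 1) ` SL2Z" by blast
next
  fix v :: "int^2" assume "v \<in> (\<lambda>A. A *v axis 1 1) ` SL2Z"
  then obtain A where A: "A \<in> SL2Z" and v: "v = A *v axis 1 1" by blast
  have "v $ 1 = A $ 1 $ 1" "v $ 2 = A $ 2 $ 1"
    by (simp_all add: v matrix_vector_mult_def sum_2 axis_def)
  moreover have "coprime (A $ 1 $ 1) (A $ 2 $ 1)"
  proof (rule coprimeI)
    fix x assume "x dvd A $ 1 $ 1" "x dvd A $ 2 $ 1"
    then have "x dvd A $ 1 $ 1 * A $ 2 $ 2 - A $ 1 $ 2 * A $ 2 $ 1" by simp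
    then show "is_unit x" using A by (simp add: SL2Z_iff)
  qed
  ultimately show "v \<in> {v. coprime (v $ 1) (v $ 2)}" by simp
qed

text \<open>
  All representatives with bottom row $(1, j)$ have the same first column $(0, 1)$, hence give the
  same cusp. Only those with bottom row $(p j, 1)$ remain, and there are $p^n$ of them.
\<close>

lemma card_cusps_le:
  assumes p: "prime p"
  shows "card (cusps (p ^ Suc n)) \<le> 1 + p ^ n"
proof -
  let ?G = "Gamma0 (p ^ Suc n)"
  let ?o = "\<lambda>v. (\<lambda>g. g *v v) ` ?G" and ?e = "axis 1 1 :: int^2"
  have "cusps (p ^ Suc n) = (\<lambda>A. ?o (A *v ?e)) ` coset_reps p n"
    unfolding cusps_def primitive_columns
    by (rule orbits_eq_image_coset_reps) (auto simp: p matrix_vector_mul_assoc)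
  also have "\<dots> \<subseteq> insert (?o (axis 2 1)) ((\<lambda>j. ?o (mat2 1 0 (int (p * j)) 1 *v ?e)) ` {..<p ^ n})"
  proof -
    have "mat2 0 (-1) 1 j *v ?e = axis 2 1" for j
      by (simp add: vec_eq_iff forall_2 matrix_vector_mult_def sum_2 axis_def)
    then show ?thesis by (auto simp: coset_reps_def)
  qed
  finally have "card (cusps (p ^ Suc n)) \<le>
      card (insert (?o (axis 2 1)) ((\<lambda>j. ?o (mat2 1 0 (int (p * j)) 1 *v ?e)) ` {..<p ^ n}))"
    by (intro card_mono) auto
  also have "\<dots> \<le> Suc (card ((\<lambda>j. ?o (mat2 1 0 (int (p * j)) 1 *v ?e)) ` {..<p ^ n}))"
    by (rule card_insert_le_m1) simp_all
  also have "\<dots> \<le> Suc (p ^ n)"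
    using card_image_le[of "{..<p ^ n}"] by simp
  finally show ?thesis by simp
qed

section \<open>Moebius transformations away from the real line\<close>

lemma moebius_denominator_nonzero:
  assumes "A \<in> SL2Z" "Im z \<noteq> 0"
  shows "of_int (A $ 2 $ 1) * z + of_int (A $ 2 $ 2) \<noteq> 0"
proof
  assume eq: "of_int (A $ 2 $ 1) * z + of_int (A $ 2 $ 2) = 0"
  have "Im (of_int (A $ 2 $ 1) * z + of_int (A $ 2 $ 2)) = of_int (A $ 2 $ 1) * Im z" by simp
  with eq assms(2) have "A $ 2 $ 1 = 0" by simp
  moreover from this eq have "A $ 2 $ 2 = 0" by simp
  ultimately show False using assms(1) by (simp add: SL2Z_iff)
qed

lemma moebius_one: "moebius (mat 1) z = z"
  by (simp add: moebius_def)

lemma moebius_mult: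
  assumes "A \<in> SL2Z" "B \<in> SL2Z" "Im z \<noteq> 0"
  shows "moebius (A ** B) z = moebius A (moebius B z)"
proof -
  have 1: "of_int (B $ 2 $ 1) * z + of_int (B $ 2 $ 2) \<noteq> 0"
    using moebius_denominator_nonzero assms by blast
  have 2: "of_int ((A ** B) $ 2 $ 1) * z + of_int ((A ** B) $ 2 $ 2) \<noteq> 0"
    using moebius_denominator_nonzero assms SL2Z_mult by blast
  define n d where "n = of_int (B $ 1 $ 1) * z + of_int (B $ 1 $ 2)"
    and "d = of_int (B $ 2 $ 1) * z + of_int (B $ 2 $ 2)"
  have d: "d \<noteq> 0" using 1 by (simp add: d_def)
  have "moebius (A ** B) z =
     (of_int (A $ 1 $ 1) * n + of_int (A $ 1 $ 2) * d) / (of_int (A $ 2 $ 1) * n + of_int (A $ 2 $ 2) * d)"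
    by (simp add: moebius_def mat2_mult_nth n_def d_def algebra_simps)
  also have "\<dots> = (of_int (A $ 1 $ 1) * (n / d) + of_int (A $ 1 $ 2)) / (of_int (A $ 2 $ 1) * (n / d) + of_int (A $ 2 $ 2))"
    using d by (simp add: add_divide_distrib[symmetric] divide_simps)
  finally show ?thesis by (simp add: moebius_def n_def d_def)
qed


section \<open>Points over $i$ and $\rho$\<close>

text \<open>
  Outside the image of the exceptional set $E$ all fibres have exactly $k$ elements; the at most
  \<open>card E\<close> remaining values contribute an error of at most $k$ each.
\<close>

lemma card_image_fibre_bounds:
  assumes fin: "finite T" and E: "E \<subseteq> T"
    and le: "\<And>t. t \<in> T \<Longrightarrow> card {s \<in> T. f s = f t} \<le> k"
    and eq: "\<And>t. t \<in> T - E \<Longrightarrow> card {s \<in> T. f s = f t} = k"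
  shows "card T \<le> k * card (f ` T)" and "k * card (f ` T) \<le> card T + k * card E"
proof -
  have sum: "card T = (\<Sum>y\<in>f ` T. card {s \<in> T. f s = y})"
    unfolding card_eq_sum by (rule sum.image_gen[OF fin])
  also have "\<dots> \<le> (\<Sum>y\<in>f ` T. k)"
    by (intro sum_mono) (use le in auto)
  finally show "card T \<le> k * card (f ` T)" by (simp add: mult.commute)
  have "k * card (f ` T - f ` E) = (\<Sum>y\<in>f ` T - f ` E. card {s \<in> T. f s = y})"
    using eq by (subst sum.cong[OF refl, of _ _ "\<lambda>_. k"]) (auto simp: image_iff)
  also have "\<dots> \<le> card T"
    unfolding sum using fin by (intro sum_mono2) auto
  finally have "k * card (f ` T - f ` E) \<le> card T" .
  moreover have "card (f ` T) \<le> card (f ` T - f ` E) + card E"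
  proof -
    have "finite E" using E fin finite_subset by blast
    moreover have "card (f ` T) \<le> card ((f ` T - f ` E) \<union> f ` E)"
      using fin \<open>finite E\<close> by (intro card_mono) auto
    ultimately show ?thesis
      using card_Un_le[of "f ` T - f ` E" "f ` E"] card_image_le[of E f] by linarith
  qed
  then have "k * card (f ` T) \<le> k * card (f ` T - f ` E) + k * card E"
    by (metis distrib_left mult_le_mono2)
  ultimately show "k * card (f ` T) \<le> card T + k * card E" by linarith
qed

text \<open>
  For two roots $j, l$ the difference of the values factors as $(j - l)(j + l - b)$. If $p$ divided
  both factors, it would divide $2j - b$ and hence the discriminant $b^2 - 4$. So one factor is prime
  to $p$ and the other is divisible by $p^{n+1}$, which leaves only $j = l$ or $j = b - l$.
\<close>

lemma card_quadratic_roots_le_2: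
  fixes b :: int
  assumes p: "prime p" and disc: "\<not> int p dvd b\<^sup>2 - 4"
  shows "card {j. j < p ^ Suc n \<and> int (p ^ Suc n) dvd (int j)\<^sup>2 - b * int j + 1} \<le> 2"
    (is "card ?S \<le> 2")
proof (cases "?S = {}")
  case False
  then obtain l where l: "l \<in> ?S" by blast
  let ?N = "int (p ^ Suc n)"
  have N: "?N > 0" using p by (simp add: prime_gt_0_nat)
  have pN: "int p dvd ?N" by simp
  have cop: "coprime ?N u" if "\<not> int p dvd u" for u
    using prime_imp_coprime[of "int p" u] that p by simp
  have "?S \<subseteq> {l, nat ((b - int l) mod ?N)}"
  proof
    fix j assume j: "j \<in> ?S"
    have "?N dvd ((int j)\<^sup>2 - b * int j + 1) - ((int l)\<^sup>2 - b * int l + 1)"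
      using j l by (intro dvd_diff) auto
    also have "\<dots> = (int j - int l) * (int j + int l - b)"
      by (simp add: power2_eq_square algebra_simps)
    finally have prod: "?N dvd (int j - int l) * (int j + int l - b)" .
    have "\<not> (int p dvd int j - int l \<and> int p dvd int j + int l - b)"
    proof
      assume "int p dvd int j - int l \<and> int p dvd int j + int l - b"
      then have "int p dvd (int j - int l) + (int j + int l - b)" by (intro dvd_add) auto
      then have "int p dvd (2 * int j - b) * (2 * int j - b)" by simp
      moreover have "int p dvd (int j)\<^sup>2 - b * int j + 1" using j pN dvd_trans by blast
      ultimately have "int p dvd (2 * int j - b) * (2 * int j - b) - 4 * ((int j)\<^sup>2 - b * int j + 1)"
        by (metis dvd_diff dvd_mult)
      also have "\<dots> = b\<^sup>2 - 4" by (simp add: power2_eq_square algebra_simps)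
      finally show False using disc by simp
    qed
    then consider "\<not> int p dvd int j - int l" | "\<not> int p dvd int j + int l - b" by blast
    then show "j \<in> {l, nat ((b - int l) mod ?N)}"
    proof cases
      case 1
      then have "?N dvd int j + int l - b"
        using prod cop coprime_dvd_mult_right_iff by blast
      then have "?N dvd int j - (b - int l)" by (simp add: algebra_simps)
      then have "int j mod ?N = (b - int l) mod ?N" by (simp only: mod_eq_dvd_iff)
      moreover have "int j mod ?N = int j" using j by (intro mod_pos_pos_trivial) (auto simp del: power_Suc of_nat_power)
      ultimately show ?thesis by (metis insertCI nat_int)
    next
      case 2
      then have "?N dvd int j - int l"
        using prod cop coprime_dvd_mult_left_iff by blast
      then have "j = l" using j l by (intro eq_if_dvd_diff_less) auto
      then show ?thesis by simp
    qed
  qed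
  then have "card ?S \<le> card {l, nat ((b - int l) mod ?N)}" by (intro card_mono) auto
  also have "\<dots> \<le> 2" by (simp add: card_insert_if)
  finally show ?thesis .
qed (metis card.empty le0)

text \<open>
  With $W = (0, -1; 1, b)$, the matrix of trace $b$ fixing the root of $\tau^2 + b \tau + 1$, this is
  up to sign \<open>bottom_cross A (A ** W)\<close>. It vanishes modulo $N$ iff right multiplication by
  $W$ fixes the coset of $A$.
\<close>

definition norm_form :: "int \<Rightarrow> int^2^2 \<Rightarrow> int" where
  "norm_form b A = (A $ 2 $ 1)\<^sup>2 - b * A $ 2 $ 1 * A $ 2 $ 2 + (A $ 2 $ 2)\<^sup>2"

text \<open>
  At a bottom row $(p j, 1)$ the form is 1 modulo $p$; at $(1, j)$ it is $j^2 - b j + 1$.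
\<close>

lemma card_norm_form_zeros_le_2:
  assumes p: "prime p" and disc: "\<not> int p dvd b\<^sup>2 - 4"
  shows "card {A \<in> coset_reps p n. int (p ^ Suc n) dvd norm_form b A} \<le> 2"
proof -
  let ?S = "{j. j < p ^ Suc n \<and> int (p ^ Suc n) dvd (int j)\<^sup>2 - b * int j + 1}"
  have no: "\<not> int (p ^ Suc n) dvd norm_form b (mat2 1 0 (int (p * j)) 1)" for j
  proof
    assume "int (p ^ Suc n) dvd norm_form b (mat2 1 0 (int (p * j)) 1)"
    then have "int p dvd norm_form b (mat2 1 0 (int (p * j)) 1)"
      by (metis dvd_trans dvd_triv_left of_nat_dvd_iff power_Suc)
    also have "norm_form b (mat2 1 0 (int (p * j)) 1) = int p * (int j * (int p * int j - b)) + 1"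
      by (simp add: norm_form_def power2_eq_square algebra_simps)
    finally have "int p dvd 1" by (metis dvd_add_right_iff dvd_triv_left)
    then show False using p by (simp add: prime_nat_iff)
  qed
  have "{A \<in> coset_reps p n. int (p ^ Suc n) dvd norm_form b A} \<subseteq> (\<lambda>j. mat2 0 (-1) 1 (int j)) ` ?S"
  proof
    fix A assume A: "A \<in> {A \<in> coset_reps p n. int (p ^ Suc n) dvd norm_form b A}"
    then obtain j where j: "j < p ^ Suc n" "A = mat2 0 (-1) 1 (int j)"
      using no unfolding coset_reps_def by blast
    moreover from A j have "int (p ^ Suc n) dvd (int j)\<^sup>2 - b * int j + 1"
      by (simp add: norm_form_def algebra_simps)
    ultimately show "A \<in> (\<lambda>j. mat2 0 (-1) 1 (int j)) ` ?S" by blast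
  qed
  then have "card {A \<in> coset_reps p n. int (p ^ Suc n) dvd norm_form b A} \<le> card ?S"
    by (intro surj_card_le) auto
  with card_quadratic_roots_le_2[OF p disc] show ?thesis by (meson le_trans)
qed

text \<open>
  Here $K$ represents the stabiliser of $\tau$ modulo $\pm 1$. The fibre over the point of $A \tau$ is
  the set of cosets of $A k$ with $k$ in $K$. By the hypothesis \<open>cross\<close>, these are pairwise
  different unless the norm form vanishes at $A$ modulo $p^{n+1}$, so there are at most two
  exceptional cosets.
\<close>

lemma card_elliptic_points:
  fixes \<tau> :: complex and K :: "(int^2^2) set" and b :: int and n :: nat
  assumes p: "prime p" and disc: "\<not> int p dvd b\<^sup>2 - 4" and \<tau>: "Im \<tau> \<noteq> 0"
    and K: "finite K" "K \<subseteq> SL2Z"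
    and stab: "\<And>k. k \<in> SL2Z \<Longrightarrow> moebius k \<tau> = \<tau> \<longleftrightarrow> k \<in> K \<or> - k \<in> K"
    and cross: "\<And>A k k'. k \<in> K \<Longrightarrow> k' \<in> K \<Longrightarrow> k \<noteq> k' \<Longrightarrow>
      \<bar>bottom_cross (A ** k) (A ** k')\<bar> = \<bar>norm_form b A\<bar>"
  defines "P \<equiv> orbits (Gamma0 (p ^ Suc n)) moebius ((\<lambda>A. moebius A \<tau>) ` SL2Z)"
  shows "p ^ Suc n + p ^ n \<le> card K * card P"
    and "card K * card P \<le> p ^ Suc n + p ^ n + card K * 2"
proof -
  let ?N = "p ^ Suc n" and ?T = "coset_reps p n"
  let ?G = "Gamma0 (p ^ Suc n)"
  let ?c = "\<lambda>A. (\<lambda>g. g ** A) ` ?G"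
  define f where "f A = (\<lambda>g. moebius g (moebius A \<tau>)) ` ?G" for A
  define E where "E = {A \<in> ?T. int ?N dvd norm_form b A}"
  have P: "P = f ` ?T"
    unfolding P_def f_def
    by (rule orbits_eq_image_coset_reps) (use p \<tau> in \<open>auto simp: moebius_one moebius_mult\<close>)
  have f_eq: "f A = f B \<longleftrightarrow> (\<exists>k\<in>K. ?c (A ** k) = ?c B)" if A: "A \<in> SL2Z" and B: "B \<in> SL2Z" for A B
  proof -
    have "f A = f B \<longleftrightarrow> (\<exists>g\<in>?G. moebius B \<tau> = moebius g (moebius A \<tau>))"
      unfolding f_def
      by (rule orbit_eq_iff)
        (use A \<tau> in \<open>auto simp: moebius_one moebius_mult[symmetric] Gamma0_SL2Z SL2Z_mult matrix_mul_assoc\<close>)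
    also have "\<dots> \<longleftrightarrow> (\<exists>k\<in>K. \<exists>g\<in>?G. B = g ** (A ** k))"
    proof
      assume "\<exists>g\<in>?G. moebius B \<tau> = moebius g (moebius A \<tau>)"
      then obtain g where g: "g \<in> ?G" and eq: "moebius B \<tau> = moebius (g ** A) \<tau>"
        using A \<tau> by (metis Gamma0_SL2Z moebius_mult)
      define C where "C = g ** A"
      have C: "C \<in> SL2Z" using g A by (simp add: C_def Gamma0_SL2Z SL2Z_mult)
      define k where "k = adj2 C ** B"
      have k: "k \<in> SL2Z" using B C by (simp add: k_def SL2Z_mult SL2Z_adj2)
      have "moebius k \<tau> = moebius (adj2 C) (moebius C \<tau>)"
        unfolding k_def using B C \<tau> eq by (simp add: moebius_mult SL2Z_adj2 C_def)
      also have "\<dots> = \<tau>"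
        using C \<tau> by (simp add: moebius_mult[symmetric] SL2Z_adj2 adj2_mult moebius_one)
      finally have "k \<in> K \<or> - k \<in> K" using stab k by blast
      moreover have "B = C ** k"
        unfolding k_def using C by (simp add: matrix_mul_assoc adj2_mult)
      then have "B = g ** (A ** k)" by (simp add: C_def matrix_mul_assoc)
      \<comment> \<open>A sign of \<open>k\<close> can be moved into \<open>g\<close>, as $-1$ lies in $\Gamma_0(N)$.\<close>
      moreover from this have "B = (- g) ** (A ** (- k))"
        by (simp add: mat2_eq_iff mat2_mult_nth algebra_simps)
      moreover have "- g \<in> ?G" using g by (simp add: Gamma0_def SL2Z_iff)
      ultimately show "\<exists>k\<in>K. \<exists>g\<in>?G. B = g ** (A ** k)" using g by blast
    next
      assume "\<exists>k\<in>K. \<exists>g\<in>?G. B = g ** (A ** k)"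
      then obtain k g where kg: "k \<in> K" "g \<in> ?G" "B = g ** (A ** k)" by blast
      have "moebius k \<tau> = \<tau>" using stab kg(1) K(2) by blast
      then have "moebius B \<tau> = moebius g (moebius A \<tau>)"
        using kg K(2) A \<tau> by (auto simp: moebius_mult SL2Z_mult Gamma0_SL2Z subset_iff)
      with kg(2) show "\<exists>g\<in>?G. moebius B \<tau> = moebius g (moebius A \<tau>)" by blast
    qed
    also have "\<dots> \<longleftrightarrow> (\<exists>k\<in>K. ?c (A ** k) = ?c B)"
      using A B K(2) by (intro bex_cong refl) (simp add: coset_orbits_eq_iff coset_eq_iff SL2Z_mult subsetD del: power_Suc)
    finally show ?thesis .
  qed
  have fibre: "card {B \<in> ?T. f B = f A} = card ((\<lambda>k. ?c (A ** k)) ` K)" if A: "A \<in> ?T" for A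
  proof -
    have AS: "A \<in> SL2Z" using A coset_reps_SL2Z by blast
    have "inj_on ?c ?T"
      using coset_reps_unique[OF p] coset_reps_SL2Z
      by (intro inj_onI) (simp add: coset_orbits_eq_iff del: power_Suc)
    then have "card {B \<in> ?T. f B = f A} = card (?c ` {B \<in> ?T. f B = f A})"
      by (metis (no_types, lifting) card_image inj_on_subset mem_Collect_eq subsetI)
    also have "?c ` {B \<in> ?T. f B = f A} = (\<lambda>k. ?c (A ** k)) ` K"
    proof (intro equalityI subsetI)
      fix X assume "X \<in> ?c ` {B \<in> ?T. f B = f A}"
      then obtain B where B: "B \<in> ?T" "f A = f B" "X = ?c B" by auto
      then have "\<exists>k\<in>K. ?c (A ** k) = ?c B" using f_eq AS coset_reps_SL2Z by blast
      with B show "X \<in> (\<lambda>k. ?c (A ** k)) ` K" by blast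
    next
      fix X assume "X \<in> (\<lambda>k. ?c (A ** k)) ` K"
      then obtain k where k: "k \<in> K" "X = ?c (A ** k)" by blast
      have Ak: "A ** k \<in> SL2Z" using AS k K(2) SL2Z_mult by blast
      then obtain B where B: "B \<in> ?T" "int ?N dvd bottom_cross B (A ** k)"
        using coset_reps_exists[OF p] by blast
      then have "?c B = ?c (A ** k)" using Ak coset_reps_SL2Z coset_orbits_eq_iff by blast
      moreover from this have "f A = f B" using f_eq[OF AS] B(1) coset_reps_SL2Z k(1) by metis
      ultimately show "X \<in> ?c ` {B \<in> ?T. f B = f A}"
        using B(1) k(2) by (intro image_eqI[of _ _ B]) auto
    qed
    finally show ?thesis .
  qed
  have le: "card {B \<in> ?T. f B = f A} \<le> card K" if "A \<in> ?T" for A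
    unfolding fibre[OF that] by (rule card_image_le[OF K(1)])
  have eq: "card {B \<in> ?T. f B = f A} = card K" if A: "A \<in> ?T - E" for A
  proof -
    have AS: "A \<in> SL2Z" using A coset_reps_SL2Z by blast
    have "inj_on (\<lambda>k. ?c (A ** k)) K"
    proof (rule inj_onI, rule ccontr)
      fix k k' assume k: "k \<in> K" "k' \<in> K" "?c (A ** k) = ?c (A ** k')" "k \<noteq> k'"
      have "A ** k \<in> SL2Z" "A ** k' \<in> SL2Z" using AS k K(2) SL2Z_mult by blast+
      then have "int ?N dvd bottom_cross (A ** k) (A ** k')"
        using k(3) coset_orbits_eq_iff by blast
      then have "int ?N dvd norm_form b A"
        using cross[OF k(1,2,4)] by (metis dvd_abs_iff)
      then show False using A by (simp add: E_def)
    qed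
    then show ?thesis using A fibre by (simp add: card_image)
  qed
  have ET: "E \<subseteq> ?T" by (auto simp: E_def)
  show "?N + p ^ n \<le> card K * card P"
    using card_image_fibre_bounds(1)[OF finite_coset_reps ET le eq] P card_coset_reps[OF p] by simp
  have "card E \<le> 2" using card_norm_form_zeros_le_2[OF p disc] by (simp add: E_def)
  then have "card K * card E \<le> card K * 2" by (rule mult_le_mono2)
  with card_image_fibre_bounds(2)[OF finite_coset_reps ET le eq]
  show "card K * card P \<le> ?N + p ^ n + card K * 2"
    unfolding P card_coset_reps[OF p] by linarith
qed

text \<open>
  The fixed point equation is quadratic in $\tau$ with integer coefficients. Subtracting a multiple of
  $\tau^2 + b \tau + 1 = 0$ makes it linear, and a linear relation over the integers for a non-real
  number is trivial.
\<close>

lemma moebius_fixed_iff: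
  fixes b :: int
  assumes A: "A \<in> SL2Z" and \<tau>: "Im \<tau> \<noteq> 0" "\<tau>\<^sup>2 + of_int b * \<tau> + 1 = 0"
  shows "moebius A \<tau> = \<tau> \<longleftrightarrow>
    A $ 1 $ 2 = - (A $ 2 $ 1) \<and> A $ 2 $ 2 = A $ 1 $ 1 + b * A $ 2 $ 1"
proof -
  define x y where "x = A $ 1 $ 1 - A $ 2 $ 2 + b * A $ 2 $ 1" and "y = A $ 1 $ 2 + A $ 2 $ 1"
  have "moebius A \<tau> = \<tau> \<longleftrightarrow>
      of_int (A $ 1 $ 1) * \<tau> + of_int (A $ 1 $ 2) = \<tau> * (of_int (A $ 2 $ 1) * \<tau> + of_int (A $ 2 $ 2))"
    using moebius_denominator_nonzero[OF A \<tau>(1)] by (simp add: moebius_def divide_eq_eq)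
  also have "\<dots> \<longleftrightarrow> of_int x * \<tau> + of_int y = of_int (A $ 2 $ 1) * (\<tau>\<^sup>2 + of_int b * \<tau> + 1)"
    by (simp add: x_def y_def power2_eq_square algebra_simps)
  also have "\<dots> \<longleftrightarrow> of_int x * \<tau> + of_int y = 0" using \<tau>(2) by simp
  also have "\<dots> \<longleftrightarrow> x = 0 \<and> y = 0"
  proof
    assume eq: "of_int x * \<tau> + of_int y = 0"
    have "Im (of_int x * \<tau> + of_int y) = of_int x * Im \<tau>" by simp
    with eq \<tau>(1) have "x = 0" by simp
    with eq show "x = 0 \<and> y = 0" by simp
  qed auto
  finally show ?thesis by (auto simp: x_def y_def)
qed

lemma sum_squares_eq_one_int:
  fixes a c :: int
  assumes "a * a + c * c = 1"
  shows "(a, c) \<in> {(1, 0), (-1, 0), (0, 1), (0, -1)}"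
proof -
  have "a\<^sup>2 \<le> 1" "c\<^sup>2 \<le> 1" using assms by (auto simp: power2_eq_square) (smt (verit) zero_le_square)+
  then have "a \<in> {-1, 0, 1}" "c \<in> {-1, 0, 1}" by (auto simp: abs_square_le_1)
  with assms show ?thesis by auto
qed

lemma hexagonal_form_eq_one_int:
  fixes a c :: int
  assumes "a * a + a * c + c * c = 1"
  shows "(a, c) \<in> {(1, 0), (-1, 0), (0, 1), (0, -1), (1, -1), (-1, 1)}"
proof -
  have "3 * a\<^sup>2 + (a + 2 * c)\<^sup>2 = 4" "3 * c\<^sup>2 + (c + 2 * a)\<^sup>2 = 4"
    using assms by (auto simp: power2_eq_square algebra_simps)
  then have "3 * a\<^sup>2 \<le> 4" "3 * c\<^sup>2 \<le> 4" by (smt (verit) zero_le_power2)+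
  then have "a\<^sup>2 \<le> 1" "c\<^sup>2 \<le> 1" by linarith+
  then have "a \<in> {-1, 0, 1}" "c \<in> {-1, 0, 1}" by (auto simp: abs_square_le_1)
  with assms show ?thesis by auto
qed

lemma card_points_over_i:
  assumes p: "prime p" "p > 3"
  shows "p ^ Suc n + p ^ n \<le> 2 * card (points_over_i (p ^ Suc n))"
    and "2 * card (points_over_i (p ^ Suc n)) \<le> p ^ Suc n + p ^ n + 4"
proof -
  let ?K = "{mat 1, mat2 0 (-1) 1 0}"
  have card: "card ?K = 2" by (simp add: mat2_eq_iff card_insert_if)
  have disc: "\<not> int p dvd 0\<^sup>2 - 4"
  proof
    assume "int p dvd 0\<^sup>2 - 4"
    then have "int p dvd 2 * 2" by simp
    then have "p dvd 2 * 2" by presburger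
    then have "p dvd 2" using p(1) by (simp only: prime_dvd_mult_iff) blast
    then show False using p(2) by (auto dest: dvd_imp_le)
  qed
  have stab: "moebius k \<i> = \<i> \<longleftrightarrow> k \<in> ?K \<or> - k \<in> ?K" if k: "k \<in> SL2Z" for k
  proof -
    have "moebius k \<i> = \<i> \<longleftrightarrow> k $ 1 $ 2 = - (k $ 2 $ 1) \<and> k $ 2 $ 2 = k $ 1 $ 1"
      using moebius_fixed_iff[of k \<i> 0] k by simp
    also have "\<dots> \<longleftrightarrow> k \<in> ?K \<or> - k \<in> ?K"
      using sum_squares_eq_one_int[of "k $ 1 $ 1" "k $ 2 $ 1"] k
      by (auto simp: mat2_eq_iff SL2Z_iff)
    finally show ?thesis .
  qed
  have cross: "\<bar>bottom_cross (A ** k) (A ** k')\<bar> = \<bar>norm_form 0 A\<bar>"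
    if "k \<in> ?K" "k' \<in> ?K" "k \<noteq> k'" for A k k'
    using that by (auto simp: bottom_cross_def norm_form_def mat2_mult_nth power2_eq_square algebra_simps abs_if)
  note * = card_elliptic_points[OF p(1) disc _ _ _ stab cross, where n = n, folded points_over_i_def, unfolded card]
  show "p ^ Suc n + p ^ n \<le> 2 * card (points_over_i (p ^ Suc n))"
    by (rule *) (auto simp: SL2Z_iff)
  have "2 * card (points_over_i (p ^ Suc n)) \<le> p ^ Suc n + p ^ n + 2 * 2"
    by (rule *) (auto simp: SL2Z_iff)
  then show "2 * card (points_over_i (p ^ Suc n)) \<le> p ^ Suc n + p ^ n + 4" by simp
qed

text \<open>
  The powers of $(0, -1; 1, 1)$, an element of order 6, up to sign.
\<close>

definition rho_stabiliser :: "(int^2^2) set" where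
  "rho_stabiliser = {mat 1, mat2 0 (-1) 1 1, mat2 (-1) (-1) 1 0}"

lemma rho_stabiliser_iff:
  assumes k: "k \<in> SL2Z"
  shows "k $ 1 $ 2 = - (k $ 2 $ 1) \<and> k $ 2 $ 2 = k $ 1 $ 1 + k $ 2 $ 1 \<longleftrightarrow>
    k \<in> rho_stabiliser \<or> - k \<in> rho_stabiliser" (is "?L \<longleftrightarrow> ?R")
proof
  assume L: ?L
  then have "k $ 1 $ 1 * k $ 1 $ 1 + k $ 1 $ 1 * k $ 2 $ 1 + k $ 2 $ 1 * k $ 2 $ 1 = 1"
    using k by (simp add: SL2Z_iff distrib_left)
  from hexagonal_form_eq_one_int[OF this] have
    "k $ 1 $ 1 = 1 \<and> k $ 2 $ 1 = 0 \<or> k $ 1 $ 1 = -1 \<and> k $ 2 $ 1 = 0 \<or>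
     k $ 1 $ 1 = 0 \<and> k $ 2 $ 1 = 1 \<or> k $ 1 $ 1 = 0 \<and> k $ 2 $ 1 = -1 \<or>
     k $ 1 $ 1 = 1 \<and> k $ 2 $ 1 = -1 \<or> k $ 1 $ 1 = -1 \<and> k $ 2 $ 1 = 1"
    by simp
  with L show ?R
    by (elim disjE conjE) (simp_all add: rho_stabiliser_def mat2_eq_iff)
qed (auto simp: rho_stabiliser_def mat2_eq_iff)

lemma bottom_cross_rho_stabiliser:
  assumes "k \<in> rho_stabiliser" "k' \<in> rho_stabiliser" "k \<noteq> k'"
  shows "\<bar>bottom_cross (A ** k) (A ** k')\<bar> = \<bar>norm_form 1 A\<bar>"
proof -
  have "bottom_cross (A ** k) (A ** k') \<in> {norm_form 1 A, - norm_form 1 A}"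
    using assms unfolding rho_stabiliser_def
    by (elim insertE emptyE;
        simp add: bottom_cross_def norm_form_def mat2_mult_nth power2_eq_square;
        simp add: algebra_simps)
  then show ?thesis by auto
qed

lemma card_points_over_rho:
  assumes p: "prime p" "p > 3"
  shows "p ^ Suc n + p ^ n \<le> 3 * card (points_over_rho (p ^ Suc n))"
    and "3 * card (points_over_rho (p ^ Suc n)) \<le> p ^ Suc n + p ^ n + 6"
proof -
  let ?\<rho> = "cis (2 * pi / 3)"
  have card: "card rho_stabiliser = 3"
    by (simp add: rho_stabiliser_def mat2_eq_iff card_insert_if)
  have disc: "\<not> int p dvd 1\<^sup>2 - 4"
  proof
    assume "int p dvd 1\<^sup>2 - 4"
    then have "int p dvd int 3" by simp
    then have "p dvd 3" by (simp only: of_nat_dvd_iff)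
    then show False using p(2) by (auto dest: dvd_imp_le)
  qed
  have \<rho>: "?\<rho> = Complex (- 1 / 2) (sqrt 3 / 2)"
    by (simp add: complex_eq_iff cos_120 sin_120)
  have Im: "Im ?\<rho> \<noteq> 0" by (simp add: \<rho>)
  have root: "?\<rho>\<^sup>2 + of_int 1 * ?\<rho> + 1 = 0"
    unfolding \<rho> by (simp add: complex_eq_iff power2_eq_square)
  have stab: "moebius k ?\<rho> = ?\<rho> \<longleftrightarrow> k \<in> rho_stabiliser \<or> - k \<in> rho_stabiliser"
    if k: "k \<in> SL2Z" for k
    using moebius_fixed_iff[OF k Im root] rho_stabiliser_iff[OF k] by simp
  note * = card_elliptic_points[OF p(1) disc Im _ _ stab bottom_cross_rho_stabiliser, where n = n, folded points_over_rho_def, unfolded card]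
  show "p ^ Suc n + p ^ n \<le> 3 * card (points_over_rho (p ^ Suc n))"
    by (rule *) (auto simp: rho_stabiliser_def SL2Z_iff)
  have "3 * card (points_over_rho (p ^ Suc n)) \<le> p ^ Suc n + p ^ n + 3 * 2"
    by (rule *) (auto simp: rho_stabiliser_def SL2Z_iff)
  then show "3 * card (points_over_rho (p ^ Suc n)) \<le> p ^ Suc n + p ^ n + 6" by simp
qed

section \<open>The genus\<close>

lemma genus_X0_bounds:
  assumes p: "prime p" "p > 3"
  shows "real (p ^ Suc n + p ^ n) / 12 - 3 / 2 - real (p ^ n) / 2 \<le> genus_X0 (p ^ Suc n)"
    and "genus_X0 (p ^ Suc n) \<le> real (p ^ Suc n + p ^ n) / 12 + 1"
proof -
  define d where "d = p ^ Suc n + p ^ n"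
  define e\<^sub>2 e\<^sub>3 c where "e\<^sub>2 = card (points_over_i (p ^ Suc n))"
    and "e\<^sub>3 = card (points_over_rho (p ^ Suc n))" and "c = card (cusps (p ^ Suc n))"
  have "d \<le> 2 * e\<^sub>2" "2 * e\<^sub>2 \<le> d + 4" "d \<le> 3 * e\<^sub>3" "3 * e\<^sub>3 \<le> d + 6" "c \<le> 1 + p ^ n"
    unfolding d_def e\<^sub>2_def e\<^sub>3_def c_def
    using card_points_over_i[OF p] card_points_over_rho[OF p] card_cusps_le[OF p(1)] by blast+
  then have bounds: "real d \<le> 2 * real e\<^sub>2" "2 * real e\<^sub>2 \<le> real d + 4" "real d \<le> 3 * real e\<^sub>3"
    "3 * real e\<^sub>3 \<le> real d + 6" "real c \<le> 1 + real (p ^ n)" "0 \<le> real c"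
    by linarith+
  have "genus_X0 (p ^ Suc n) = 1 - (real e\<^sub>2 + real e\<^sub>3 + real c - real d) / 2"
    unfolding genus_X0_def euler_char_X0_def index_Gamma0_prime_power[OF p(1)]
    by (simp add: d_def e\<^sub>2_def e\<^sub>3_def c_def algebra_simps del: power_Suc)
  with bounds show "real (p ^ Suc n + p ^ n) / 12 - 3 / 2 - real (p ^ n) / 2 \<le> genus_X0 (p ^ Suc n)"
    "genus_X0 (p ^ Suc n) \<le> real (p ^ Suc n + p ^ n) / 12 + 1"
    unfolding d_def[symmetric] by (simp_all add: field_simps)
qed

section \<open>Leading terms\<close>

lemmas intersection_number_explicit =
  intersection_number_def UNIV_fibre_component component_intersection_def intersection_matrix_def Let_def

lemmas of_rat_hom = of_rat_add of_rat_mult of_rat_divide of_rat_power of_rat_of_nat_eq of_rat_minus of_rat_diff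

text \<open>
  The multiplicities of \<open>C30\<close>, \<open>C03\<close>, \<open>C21\<close> are asymptotically $2, -1, p$ in $V_0$ and
  $-2, 1, -p$ in $V_\infty$, and only these components contribute to order $p^3$. The relevant
  entries of the matrix are asymptotically $-p^3/12$ (squares of \<open>C30\<close> and \<open>C03\<close>), $p^2/12$
  (\<open>C30\<close> with \<open>C21\<close>) and $-p/6$ (square of \<open>C21\<close>). So each square of a divisor is
  asymptotically $(-4 - 1 + 4 - 2) p^3/12 = -p^3/4$, and the mixed product has the opposite sign.
\<close>

lemma intersection_number_asymptotics:
  shows "(\<lambda>p. of_rat (intersection_number p (V_zero p) (V_infinity p)) / real p ^ 3)
      \<longlonglongrightarrow> (1 / 4 :: real)"
    and "(\<lambda>p. of_rat (intersection_number p (V_zero p) (V_zero p)) / real p ^ 3)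
      \<longlonglongrightarrow> (- (1 / 4) :: real)"
    and "(\<lambda>p. of_rat (intersection_number p (V_infinity p) (V_infinity p)) / real p ^ 3)
      \<longlonglongrightarrow> (- (1 / 4) :: real)"
  by (simp_all add: intersection_number_explicit V_zero_def V_infinity_def of_rat_hom) real_asymp+

text \<open>
  After division by $G \log p$ and cancellation of $p^3$ the expression tends to
  $(1/4) / (1/12) - 3 = 0$; the squares enter with a factor $1/G$ and drop out.
\<close>

lemma leading_term_smallo:
  fixes G I A B :: "nat \<Rightarrow> real"
  assumes F: "F \<le> sequentially"
  and G: "((\<lambda>p. G p / real p ^ 3) \<longlongrightarrow> 1 / 12) F"
  and I: "((\<lambda>p. I p / real p ^ 3) \<longlongrightarrow> 1 / 4) F"
  and A: "((\<lambda>p. A p / real p ^ 3) \<longlongrightarrow> a) F"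
  and B: "((\<lambda>p. B p / real p ^ 3) \<longlongrightarrow> b) F"
  shows "(\<lambda>p. 1 / (G p - 1) * (G p * (I p * ln (real p)) - (A p * ln (real p) + B p * ln (real p)) / 2) - 3 * G p * ln (real p))
      \<in> o[F](\<lambda>p. G p * ln (real p))"
proof (rule smalloI_tendsto)
  \<comment> \<open>With numerators and denominators scaled by \<open>p ^ 3\<close>, the terms 1 and the squares come with this factor.\<close>
  define u where "u p = 1 / real p ^ 3" for p
  have u: "(u \<longlongrightarrow> 0) F"
    unfolding u_def by (rule tendsto_mono[OF F]) real_asymp
  have large: "\<forall>\<^sub>F p in F. real p > 1"
    by (rule filter_leD[OF F]) real_asymp
  have g: "\<forall>\<^sub>F p in F. G p / real p ^ 3 > 1 / 24"
    using order_tendstoD(1)[OF G, of "1/24"] by simp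
  have g1: "\<forall>\<^sub>F p in F. G p / real p ^ 3 - u p > 1 / 24"
    using order_tendstoD(1)[OF tendsto_diff[OF G u], of "1/24"] by simp
  from large g show nz: "\<forall>\<^sub>F p in F. G p * ln (real p) \<noteq> 0"
    by eventually_elim auto
  have "((\<lambda>p. ((I p / real p ^ 3) - u p * (A p / real p ^ 3 + B p / real p ^ 3) / (2 * (G p / real p ^ 3))) /
      (G p / real p ^ 3 - u p) - 3) \<longlongrightarrow> (1 / 4 - 0 * (a + b) / (2 * (1 / 12))) / (1 / 12 - 0) - 3) F"
    by (intro tendsto_intros G I A B u) auto
  then have lim: "((\<lambda>p. ((I p / real p ^ 3) - u p * (A p / real p ^ 3 + B p / real p ^ 3) / (2 * (G p / real p ^ 3))) /
      (G p / real p ^ 3 - u p) - 3) \<longlongrightarrow> 0) F"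
    by simp
  show "((\<lambda>p. (1 / (G p - 1) * (G p * (I p * ln (real p)) - (A p * ln (real p) + B p * ln (real p)) / 2) - 3 * G p * ln (real p))
      / (G p * ln (real p))) \<longlongrightarrow> 0) F"
  proof (rule Lim_transform_eventually[OF lim])
    show "\<forall>\<^sub>F p in F. ((I p / real p ^ 3) - u p * (A p / real p ^ 3 + B p / real p ^ 3) / (2 * (G p / real p ^ 3))) /
      (G p / real p ^ 3 - u p) - 3 = 
      (1 / (G p - 1) * (G p * (I p * ln (real p)) - (A p * ln (real p) + B p * ln (real p)) / 2) - 3 * G p * ln (real p))
      / (G p * ln (real p))"
      using large g g1
    proof eventually_elim
      case (elim p)
      define q L where "q = real p ^ 3" and "L = ln (real p)"
      have q: "q > 0" and L: "L > 0" using elim(1) by (auto simp: q_def L_def)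
      have "G p > 0" using elim(2) q by (simp add: q_def[symmetric] field_simps)
      moreover have "G p - 1 > 0" using elim(3) q by (simp add: u_def q_def[symmetric] field_simps)
      ultimately show ?case
        using q L unfolding u_def q_def[symmetric] L_def[symmetric]
        by (simp add: field_simps)
    qed
  qed
qed

lemma genus_X0_cube_asymptotics:
  "((\<lambda>p. genus_X0 (p ^ 3) / real p ^ 3) \<longlongrightarrow> 1 / 12)
    (inf at_top (principal {p. prime p \<and> [p = 1] (mod 12)}))" (is "(_ \<longlongrightarrow> _) ?F")
proof (rule tendsto_sandwich)
  have F: "?F \<le> sequentially" by simp
  have "\<forall>\<^sub>F p in ?F. p > 3"
    by (rule filter_leD[OF F]) (rule eventually_gt_at_top)
  moreover have "\<forall>\<^sub>F p in ?F. prime p"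
    by (auto simp: eventually_inf_principal)
  ultimately have bounds: "\<forall>\<^sub>F p in ?F. prime p \<and> p > 3" by eventually_elim simp
  then show "\<forall>\<^sub>F p in ?F. ((real p ^ 3 + real p ^ 2) / 12 - 3 / 2 - real p ^ 2 / 2) / real p ^ 3
      \<le> genus_X0 (p ^ 3) / real p ^ 3"
  proof eventually_elim
    case (elim p)
    with genus_X0_bounds(1)[of p 2] show ?case by (intro divide_right_mono) (simp_all add: numeral_3_eq_3)
  qed
  from bounds show "\<forall>\<^sub>F p in ?F. genus_X0 (p ^ 3) / real p ^ 3
      \<le> ((real p ^ 3 + real p ^ 2) / 12 + 1) / real p ^ 3"
  proof eventually_elim
    case (elim p)
    with genus_X0_bounds(2)[of p 2] show ?case by (intro divide_right_mono) (simp_all add: numeral_3_eq_3)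
  qed
  show "((\<lambda>p. ((real p ^ 3 + real p ^ 2) / 12 - 3 / 2 - real p ^ 2 / 2) / real p ^ 3) \<longlongrightarrow> 1 / 12) ?F"
    by (rule tendsto_mono[OF F]) real_asymp
  show "((\<lambda>p. ((real p ^ 3 + real p ^ 2) / 12 + 1) / real p ^ 3) \<longlongrightarrow> 1 / 12) ?F"
    by (rule tendsto_mono[OF F]) real_asymp
qed

theorem proposition4p2:
  shows "(\<lambda>p. 1 / (genus_X0 (p^3) - 1) *
             (genus_X0 (p^3) * arakelov_pairing p (V_zero p) (V_infinity p)
              - (arakelov_pairing p (V_zero p) (V_zero p)
                 + arakelov_pairing p (V_infinity p) (V_infinity p)) / 2)
           - 3 * genus_X0 (p^3) * ln (real p))
         \<in> o[inf at_top (principal {p::nat. prime p \<and> [p = 1] (mod 12)})](\<lambda>p. genus_X0 (p^3) * ln (real p))"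
  unfolding arakelov_pairing_def
proof (rule leading_term_smallo)
  let ?F = "inf at_top (principal {p::nat. prime p \<and> [p = 1] (mod 12)})"
  show F: "?F \<le> sequentially" by simp
  show "((\<lambda>p. genus_X0 (p ^ 3) / real p ^ 3) \<longlongrightarrow> 1 / 12) ?F"
    by (rule genus_X0_cube_asymptotics)
qed (rule tendsto_mono[OF _ intersection_number_asymptotics(1)]
          tendsto_mono[OF _ intersection_number_asymptotics(2)]
          tendsto_mono[OF _ intersection_number_asymptotics(3)]; simp)+

end
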